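(* Let $R(x)=R(x,1-x)$ and $B(x)=B(x,1-x)$ for $x\in(0,1)$, where $R(a,b)=-\psi(a)-\psi(b)-2\gamma$ and $B(a,b)=\Gamma(a)\Gamma(b)/\Gamma(a+b)$. The function $$x\mapsto F(x)=R(x)-\frac{B(x)}{1+x(1-x)}$$ is completely monotonic on $(0,1/2)$.
   Context: $\Gamma$ is the gamma function, $\psi(x)=\frac{d}{dx}\ln\Gamma(x)$ is the psi (digamma) function, and $\gamma=-\psi(1)$ is the Euler constant. A function $f$ is completely monotonic on an interval $I$ if it has derivatives of all orders on $I$ and $(-1)^m f^{(m)}(x)\ge 0$ for all $x\in I$ and all integers $m\ge 0$. *)

theory Defs
  imports "HOL-Analysis.Analysis"
begin

definition Ramanujan_R :: "real \<Rightarrow> real \<Rightarrow> real" where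
  "Ramanujan_R a b = - Digamma a - Digamma b - 2 * euler_mascheroni"

(* Since deriv is two-sided, this is the usual notion only for open I. Differentiability of every
   iterate is required explicitly because deriv is total. *)
definition completely_monotonic_on :: "(real \<Rightarrow> real) \<Rightarrow> real set \<Rightarrow> bool" where
  "completely_monotonic_on f I \<longleftrightarrow>
     (\<forall>m. \<forall>x\<in>I. (deriv ^^ m) f field_differentiable at x \<and> (-1) ^ m * (deriv ^^ m) f x \<ge> 0)"

end

theory Submission
  imports Defs "HOL-Real_Asymp.Real_Asymp"
begin

text \<open>
  With \<open>y = 1/2 - x\<close>, complete monotonicity of \<open>F\<close> follows once \<open>F\<close> is a power series in \<open>y\<close>
  with nonnegative coefficients. Put \<open>a\<^sub>n = (n + 1/2)\<^sup>2\<close>. The digamma series and the expansion of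
  \<open>\<pi> / sin (\<pi> x)\<close> give \<open>R = \<Sum>\<^sub>n (2n+1)/(a\<^sub>n - y\<^sup>2) - 2/(n+1)\<close> and
  \<open>B = \<Sum>\<^sub>n (-1)\<^sup>n (2n+1)/(a\<^sub>n - y\<^sup>2)\<close>, while \<open>1 + x(1-x) = 5/4 - y\<^sup>2\<close>. Partial fractions with
  \<open>d\<^sub>n = a\<^sub>n - 5/4 = n(n+1) - 1\<close> turn \<open>F - F(1/2)\<close> into
  \<open>\<Sum>\<^sub>n (2n+1) (1 + (-1)\<^sup>n/d\<^sub>n) (1/(a\<^sub>n - y\<^sup>2) - 1/a\<^sub>n) - E (1/(5/4 - y\<^sup>2) - 4/5)\<close>
  where \<open>E = \<Sum>\<^sub>n (-1)\<^sup>n (2n+1)/d\<^sub>n\<close>. All weights \<open>1 + (-1)\<^sup>n/d\<^sub>n\<close> are nonnegative, \<open>E \<le> -3\<close>, and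
  \<open>F(1/2) = 4 ln 2 - 4\<pi>/5 > 0\<close>.
\<close>

section \<open>Power series with nonnegative coefficients\<close>

text \<open>Convergence is demanded only for positive \<open>y\<close>, where all terms are
  nonnegative; these are the points \<open>y = 1/2 - x\<close> that the goal concerns.\<close>

definition nonneg_power_series_on :: "real \<Rightarrow> (real \<Rightarrow> real) \<Rightarrow> bool" where
  "nonneg_power_series_on r f \<longleftrightarrow>
     (\<exists>c. (\<forall>k. 0 \<le> c k) \<and> (\<forall>y. 0 < y \<and> y < r \<longrightarrow> (\<lambda>k. c k * y ^ k) sums f y))"

lemma nonneg_power_series_on_monom:
  assumes "0 \<le> a"
  shows "nonneg_power_series_on r (\<lambda>y. a * y ^ m)"
  unfolding nonneg_power_series_on_def
proof (intro exI conjI allI impI)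
  show "0 \<le> (if k = m then a else 0)" for k
    using assms by simp
  show "(\<lambda>k. (if k = m then a else 0) * y ^ k) sums (a * y ^ m)" for y :: real
    using sums_single[of m "\<lambda>k. a * y ^ k"] by (simp add: if_distribR if_distrib[of "\<lambda>c. c * _"] cong: if_cong)
qed

lemma nonneg_power_series_on_add:
  assumes "nonneg_power_series_on r f" "nonneg_power_series_on r g"
  shows "nonneg_power_series_on r (\<lambda>y. f y + g y)"
proof -
  from assms obtain c d where
    "\<forall>k. 0 \<le> c k" "\<forall>y. 0 < y \<and> y < r \<longrightarrow> (\<lambda>k. c k * y ^ k) sums f y"
    "\<forall>k. 0 \<le> d k" "\<forall>y. 0 < y \<and> y < r \<longrightarrow> (\<lambda>k. d k * y ^ k) sums g y"
    unfolding nonneg_power_series_on_def by blast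
  then show ?thesis
    unfolding nonneg_power_series_on_def
    by (intro exI[of _ "\<lambda>k. c k + d k"]) (auto simp: distrib_right intro: sums_add)
qed

lemma nonneg_power_series_on_cmult:
  assumes "nonneg_power_series_on r f" "0 \<le> a"
  shows "nonneg_power_series_on r (\<lambda>y. a * f y)"
proof -
  from assms obtain c where
    "\<forall>k. 0 \<le> c k" "\<forall>y. 0 < y \<and> y < r \<longrightarrow> (\<lambda>k. c k * y ^ k) sums f y"
    unfolding nonneg_power_series_on_def by blast
  then show ?thesis
    using assms(2) unfolding nonneg_power_series_on_def
    by (intro exI[of _ "\<lambda>k. a * c k"]) (auto simp: mult.assoc intro: sums_mult)
qed

text \<open>At each \<open>y > 0\<close> the double series has nonnegative terms, so by Tonelli the
  order of summation can be exchanged; the new coefficients are the column sums of the old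
  ones.\<close>

lemma nonneg_power_series_on_sums:
  assumes f: "\<And>n. nonneg_power_series_on r (f n)"
    and g: "\<And>y. 0 < y \<Longrightarrow> y < r \<Longrightarrow> (\<lambda>n. f n y) sums g y"
  shows "nonneg_power_series_on r g"
proof -
  from f obtain c where c0: "\<And>n k. (0::real) \<le> c n k"
    and c: "\<And>n y. 0 < y \<Longrightarrow> y < r \<Longrightarrow> (\<lambda>k. c n k * y ^ k) sums f n y"
    unfolding nonneg_power_series_on_def by metis
  have "(\<lambda>k. (\<Sum>\<^sub>\<infinity>n. c n k) * y ^ k) sums g y" if y: "0 < y" "y < r" for y
  proof -
    have inner: "((\<lambda>k. c n k * y ^ k) has_sum f n y) UNIV" for n
      using c[OF y] c0 y by (intro sums_nonneg_imp_has_sum) auto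
    have "0 \<le> f n y" for n
      using c0 y by (intro has_sum_nonneg[OF inner]) auto
    then have outer: "((\<lambda>n. f n y) has_sum g y) UNIV"
      using g[OF y] by (intro sums_nonneg_imp_has_sum) auto
    have "(\<lambda>(n, k). c n k * y ^ k) summable_on (UNIV \<times> UNIV)"
      using inner outer c0 y by (intro summable_on_SigmaI[where g = "\<lambda>n. f n y"]) (auto simp: summable_on_def)
    then have "((\<lambda>(n, k). c n k * y ^ k) has_sum g y) (UNIV \<times> UNIV)"
      using inner outer by (intro has_sum_SigmaI[where g = "\<lambda>n. f n y"]) auto
    then have swapped: "((\<lambda>(k, n). c n k * y ^ k) has_sum g y) (UNIV \<times> UNIV)"
      by (subst (asm) has_sum_swap) (simp add: case_prod_unfold)
    have "(\<lambda>n. c n k * y ^ k) summable_on UNIV" for k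
      using summable_on_SigmaD1[of "\<lambda>k n. c n k * y ^ k" UNIV "\<lambda>_. UNIV" k] swapped
      by (auto simp: summable_on_def)
    \<comment> \<open>Dividing by the nonzero \<open>y ^ k\<close> shows that the column sum
      converges, so \<open>infsum\<close> is a genuine sum and not its default value.\<close>
    then have "(\<lambda>n. c n k) summable_on UNIV" for k
      using y summable_on_cmult_left'[of "y ^ k" "\<lambda>n. c n k" UNIV] by auto
    then have "((\<lambda>n. c n k * y ^ k) has_sum (\<Sum>\<^sub>\<infinity>n. c n k) * y ^ k) UNIV" for k
      by (intro has_sum_cmult_left) (auto simp: has_sum_infsum)
    then have "((\<lambda>k. (\<Sum>\<^sub>\<infinity>n. c n k) * y ^ k) has_sum g y) UNIV"
      using has_sum_SigmaD[OF swapped, of "\<lambda>k. (\<Sum>\<^sub>\<infinity>n. c n k) * y ^ k"] by simp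
    then show ?thesis
      by (rule has_sum_imp_sums)
  qed
  moreover have "0 \<le> (\<Sum>\<^sub>\<infinity>n. c n k)" for k
    by (rule infsum_nonneg) (rule c0)
  ultimately show ?thesis
    unfolding nonneg_power_series_on_def
    by (intro exI[of _ "\<lambda>k. \<Sum>\<^sub>\<infinity>n. c n k"]) simp
qed

text \<open>Geometric series in \<open>y\<^sup>2 / a\<close> with its constant term removed. The
  removal keeps the later sum over all poles convergent, although its weights grow like
  \<open>2 * n\<close>.\<close>

lemma nonneg_power_series_on_inverse_diff_square:
  assumes "0 < r" "r\<^sup>2 \<le> a"
  shows "nonneg_power_series_on r (\<lambda>y. 1 / (a - y\<^sup>2) - 1 / a)"
proof (rule nonneg_power_series_on_sums)
  have a: "0 < a"
    using less_le_trans[OF zero_less_power[OF assms(1)] assms(2)] .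
  then show "nonneg_power_series_on r (\<lambda>y. inverse (a ^ (n + 2)) * y ^ (2 * (n + 1)))" for n
    by (intro nonneg_power_series_on_monom) simp
  fix y :: real
  assume y: "0 < y" "y < r"
  then have "y\<^sup>2 < a"
    using assms(2) power_strict_mono[of y r 2] by simp
  then have "(\<lambda>n. (y\<^sup>2 / a) ^ n) sums (1 / (1 - y\<^sup>2 / a))"
    using a by (intro geometric_sums) simp
  then have "(\<lambda>n. y\<^sup>2 / a\<^sup>2 * (y\<^sup>2 / a) ^ n) sums (y\<^sup>2 / a\<^sup>2 * (1 / (1 - y\<^sup>2 / a)))"
    by (rule sums_mult)
  moreover have "y\<^sup>2 / a\<^sup>2 * (y\<^sup>2 / a) ^ n = inverse (a ^ (n + 2)) * y ^ (2 * (n + 1))" for n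
  proof -
    have "z / a\<^sup>2 * (z / a) ^ n = inverse (a ^ (n + 2)) * z ^ (n + 1)" for z
      by (simp add: divide_inverse power_mult_distrib power_inverse power2_eq_square)
    then show ?thesis
      by (simp only: power_mult)
  qed
  moreover have "y\<^sup>2 / a\<^sup>2 * (1 / (1 - y\<^sup>2 / a)) = 1 / (a - y\<^sup>2) - 1 / a"
    using a \<open>y\<^sup>2 < a\<close> by (simp add: divide_simps) (simp add: algebra_simps power2_eq_square)
  ultimately show "(\<lambda>n. inverse (a ^ (n + 2)) * y ^ (2 * (n + 1))) sums (1 / (a - y\<^sup>2) - 1 / a)"
    by simp
qed

text \<open>Termwise differentiation yields the coefficients \<open>(k + 1) * c (k + 1)\<close>,
  which are again nonnegative.\<close>

lemma nonneg_power_series_on_deriv: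
  assumes "nonneg_power_series_on r f"
  obtains f' where "nonneg_power_series_on r f'"
    and "\<And>y. 0 < y \<Longrightarrow> y < r \<Longrightarrow> (f has_real_derivative f' y) (at y)"
proof -
  from assms obtain c where c0: "\<And>k. 0 \<le> c k"
    and c: "\<And>y. 0 < y \<Longrightarrow> y < r \<Longrightarrow> (\<lambda>k. c k * y ^ k) sums f y"
    unfolding nonneg_power_series_on_def by blast
  have sm: "summable (\<lambda>k. c k * z ^ k)" if "norm z < r" for z :: real
  proof -
    \<comment> \<open>Convergence is given only at positive points; a positive \<open>w\<close>
      beyond \<open>norm z\<close> transfers it to \<open>z\<close> of either sign.\<close>
    obtain w where w: "norm z < w" "w < r"
      using \<open>norm z < r\<close> dense by blast
    then have "0 < w"
      using norm_ge_zero[of z] by linarith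
    with w c show ?thesis
      by (intro powser_inside[of c w z]) (auto simp: sums_iff)
  qed
  show ?thesis
  proof
    show "nonneg_power_series_on r (\<lambda>y. \<Sum>k. diffs c k * y ^ k)"
      unfolding nonneg_power_series_on_def
    proof (intro exI conjI allI impI)
      show "0 \<le> diffs c k" for k
        using c0 by (simp add: diffs_def)
      show "(\<lambda>k. diffs c k * y ^ k) sums (\<Sum>k. diffs c k * y ^ k)" if "0 < y \<and> y < r" for y
        using that sm by (intro summable_sums termdiff_converges[of y r]) auto
    qed
    fix y :: real
    assume y: "0 < y" "y < r"
    have "((\<lambda>y. \<Sum>k. c k * y ^ k) has_real_derivative (\<Sum>k. diffs c k * y ^ k)) (at y)"
      using y by (intro termdiffs_strong'[of r]) (auto intro: sm)
    then show "(f has_real_derivative (\<Sum>k. diffs c k * y ^ k)) (at y)"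
      by (rule has_field_derivative_transform_within_open[of _ _ _ "{0<..<r}"])
        (use y c in \<open>auto simp: sums_iff\<close>)
  qed
qed

section \<open>From power series to complete monotonicity\<close>

text \<open>By the chain rule each derivative in \<open>x\<close> contributes one factor -1, while
  the series in \<open>b - x\<close> keeps nonnegative coefficients.\<close>

lemma completely_monotonic_on_reflected_power_series:
  assumes "nonneg_power_series_on r f"
  shows "completely_monotonic_on (\<lambda>x. f (b - x)) {b - r<..<b}"
proof -
  let ?I = "{b - r<..<b}"
  let ?D = "\<lambda>m. (deriv ^^ m) (\<lambda>x. f (b - x))"
  have step: "\<exists>h'. nonneg_power_series_on r h' \<and>
      (\<forall>x\<in>?I. (?D m has_real_derivative (-1) ^ Suc m * h' (b - x)) (at x))"
    if h: "nonneg_power_series_on r h" and eq: "\<forall>x\<in>?I. ?D m x = (-1) ^ m * h (b - x)" for m h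
  proof -
    obtain h' where h': "nonneg_power_series_on r h'"
      and der: "\<And>y. 0 < y \<Longrightarrow> y < r \<Longrightarrow> (h has_real_derivative h' y) (at y)"
      using nonneg_power_series_on_deriv[OF h] by blast
    have "(?D m has_real_derivative (-1) ^ Suc m * h' (b - x)) (at x)" if x: "x \<in> ?I" for x
    \<comment> \<open>The formula for \<open>?D m\<close> is known only on \<open>?I\<close>; since
      \<open>?I\<close> is open, it may still be differentiated there.\<close>
    proof (rule has_field_derivative_transform_within_open[of _ _ _ ?I])
      have "((\<lambda>x. b - x) has_real_derivative -1) (at x)"
        by (auto intro!: derivative_eq_intros)
      moreover have "(h has_real_derivative h' (b - x)) (at (b - x))"
        using x by (intro der) auto
      ultimately have "((\<lambda>x. h (b - x)) has_real_derivative h' (b - x) * (-1)) (at x)"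
        by (rule DERIV_chain2[rotated])
      then show "((\<lambda>x. (-1) ^ m * h (b - x)) has_real_derivative (-1) ^ Suc m * h' (b - x)) (at x)"
        using DERIV_cmult[of "\<lambda>x. h (b - x)" _ x UNIV "(-1) ^ m"] by fastforce
    qed (use x eq in auto)
    with h' show ?thesis
      by blast
  qed
  have ex: "\<exists>h. nonneg_power_series_on r h \<and> (\<forall>x\<in>?I. ?D m x = (-1) ^ m * h (b - x))" for m
  proof (induction m)
    case 0
    then show ?case
      using assms by auto
  next
    case (Suc m)
    then obtain h' where "nonneg_power_series_on r h'"
      and "\<forall>x\<in>?I. (?D m has_real_derivative (-1) ^ Suc m * h' (b - x)) (at x)"
      using step by blast
    then show ?case
      using DERIV_imp_deriv by (intro exI[of _ h']) fastforce
  qed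
  show ?thesis
    unfolding completely_monotonic_on_def
  proof (intro allI ballI conjI)
    fix m x
    assume x: "x \<in> ?I"
    obtain h where h: "nonneg_power_series_on r h" "\<forall>x\<in>?I. ?D m x = (-1) ^ m * h (b - x)"
      using ex by blast
    then show "?D m field_differentiable at x"
      using step[OF h] x by (auto simp: field_differentiable_def)
    from h(1) obtain c where c: "\<forall>k. 0 \<le> c k"
      "\<forall>y. 0 < y \<and> y < r \<longrightarrow> (\<lambda>k. c k * y ^ k) sums h y"
      unfolding nonneg_power_series_on_def by blast
    have "(\<lambda>k. c k * (b - x) ^ k) sums h (b - x)"
      using c(2) x by simp
    then have "0 \<le> h (b - x)"
      by (rule sums_le[OF _ sums_zero, rotated]) (use c(1) x in simp)
    then show "0 \<le> (-1) ^ m * ?D m x"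
      by (simp only: bspec[OF h(2) x] left_minus_one_mult_self)
  qed
qed

section \<open>Reflection formulas and pole expansions of R and B\<close>

text \<open>Restriction of the complex formula. At integers both sides are 0, by the default values
  of \<open>Gamma\<close> at its poles and of division by zero.\<close>

lemma Gamma_reflection_real:
  "Gamma x * Gamma (1 - x) = pi / sin (pi * x)" for x :: real
proof -
  have "complex_of_real (Gamma x * Gamma (1 - x)) = complex_of_real (pi / sin (pi * x))"
    using Gamma_reflection_complex[of "of_real x"] Gamma_complex_of_real[of "1 - x"]
    by (simp add: Gamma_complex_of_real flip: sin_of_real)
  then show ?thesis
    by (simp only: of_real_eq_iff)
qed

lemma Beta_reflection_real: "Beta x (1 - x) = pi / sin (pi * x)" for x :: real
  using Gamma_reflection_real[of x] by (simp add: Beta_def)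

text \<open>Logarithmic differentiation of the reflection formula: both sides are differentiated and
  the common factor \<open>pi / sin (pi * x)\<close> is cancelled.\<close>

lemma Digamma_reflection_real:
  fixes x :: real
  assumes "0 < x" "x < 1"
  shows "Digamma (1 - x) - Digamma x = pi * cot (pi * x)"
proof -
  have s: "sin (pi * x) > 0"
    using assms by (intro sin_gt_zero) auto
  have ni: "x \<notin> \<int>\<^sub>\<le>\<^sub>0" "1 - x \<notin> \<int>\<^sub>\<le>\<^sub>0"
    using assms by (auto elim!: nonpos_Ints_cases)
  have "((\<lambda>x. Gamma x * Gamma (1 - x)) has_real_derivative
      Gamma x * Gamma (1 - x) * (Digamma x - Digamma (1 - x))) (at x)"
    using ni by (auto intro!: derivative_eq_intros simp: algebra_simps)
  moreover have "((\<lambda>x. pi / sin (pi * x)) has_real_derivative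
      - (pi / sin (pi * x)) * (pi * cot (pi * x))) (at x)"
    using s by (auto intro!: derivative_eq_intros simp: cot_def field_simps power2_eq_square)
  ultimately have "pi / sin (pi * x) * (Digamma x - Digamma (1 - x)) =
      - (pi / sin (pi * x)) * (pi * cot (pi * x))"
    unfolding Gamma_reflection_real by (rule DERIV_unique)
  then have "pi / sin (pi * x) * (Digamma (1 - x) - Digamma x) = pi / sin (pi * x) * (pi * cot (pi * x))"
    by (simp add: right_diff_distrib)
  then show ?thesis
    using s by simp
qed

lemma sums_Digamma_real:
  fixes x :: real
  assumes "0 < x"
  shows "(\<lambda>n. inverse (real (Suc n)) - inverse (x + real n)) sums (Digamma x + euler_mascheroni)"
  using summable_sums[OF summable_Digamma[of x]] assms by (simp add: Digamma_def)

lemma sums_Digamma_reflection_diff: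
  fixes x :: real
  assumes "0 < x" "x < 1"
  shows "(\<lambda>n. inverse (x + real n) - inverse (1 - x + real n)) sums (pi * cot (pi * x))"
  using sums_diff[OF sums_Digamma_real[of "1 - x"] sums_Digamma_real[of x]] assms
  by (simp flip: Digamma_reflection_real)

text \<open>The poles at \<open>-n\<close> and \<open>n + 1\<close> are exchanged by
  \<open>x\<close> \<rightarrow> \<open>1 - x\<close>, so their sum is even in
  \<open>y = 1/2 - x\<close>.\<close>

definition pole_pair :: "nat \<Rightarrow> real \<Rightarrow> real" where
  "pole_pair n x = 1 / (real n + x) + 1 / (real n + 1 - x)"

lemma sums_Ramanujan_R:
  assumes "0 < x" "x < 1"
  shows "(\<lambda>n. pole_pair n x - 2 / (real n + 1)) sums Ramanujan_R x (1 - x)"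
  using sums_minus[OF sums_add[OF sums_Digamma_real[of x] sums_Digamma_real[of "1 - x"]]] assms
  by (simp add: Ramanujan_R_def pole_pair_def inverse_eq_divide algebra_simps)

text \<open>Uses \<open>1 / sin t = cot (t/2) - cot t\<close>, each cotangent being a digamma difference.\<close>

lemma sums_Beta_reflection:
  assumes "0 < x" "x < 1"
  shows "(\<lambda>k. pole_pair (2 * k) x - pole_pair (2 * k + 1) x) sums Beta x (1 - x)"
proof -
  let ?u = "\<lambda>n. inverse (x + real n) - inverse (1 - x + real n)"
  \<comment> \<open>Terms \<open>2 * k\<close> and \<open>2 * k + 1\<close> are grouped because the
    k-th term of the series at \<open>x / 2\<close> has its poles among theirs.\<close>
  have "(\<lambda>k. sum ?u {k * 2..<k * 2 + 2}) sums (pi * cot (pi * x))"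
    using assms by (intro sums_group sums_Digamma_reflection_diff) auto
  moreover have "(\<lambda>k. inverse (x / 2 + real k) - inverse (1 - x / 2 + real k)) sums (pi * cot (pi * (x / 2)))"
    using assms by (intro sums_Digamma_reflection_diff) auto
  ultimately have "(\<lambda>k. inverse (x / 2 + real k) - inverse (1 - x / 2 + real k) - sum ?u {k * 2..<k * 2 + 2})
      sums (pi * cot (pi * (x / 2)) - pi * cot (pi * x))"
    by (intro sums_diff)
  moreover have "inverse (x / 2 + real k) - inverse (1 - x / 2 + real k) - sum ?u {k * 2..<k * 2 + 2} =
      pole_pair (2 * k) x - pole_pair (2 * k + 1) x" for k
  proof -
    have "inverse (x / 2 + real k) = 2 / (2 * real k + x)"
      "inverse (1 - x / 2 + real k) = 2 / (2 * real k + 2 - x)"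
      using assms by (auto simp: field_simps)
    moreover have "sum ?u {k * 2..<k * 2 + 2} = ?u (2 * k) + ?u (2 * k + 1)"
      by (simp add: numeral_2_eq_2 mult.commute)
    ultimately show ?thesis
      by (simp add: pole_pair_def inverse_eq_divide algebra_simps)
  qed
  moreover have "pi * cot (pi * (x / 2)) - pi * cot (pi * x) = pi / sin (pi * x)"
  proof -
    have "sin (pi * (x / 2)) > 0" "cos (pi * (x / 2)) > 0"
      using assms by (auto intro!: sin_gt_zero cos_gt_zero)
    moreover have "cos t / sin t - cos (2 * t) / sin (2 * t) = 1 / sin (2 * t)"
      if "sin t > 0" "cos t > 0" for t :: real
      using that unfolding sin_double cos_double_cos
      by (simp add: divide_simps) (simp add: algebra_simps power2_eq_square)
    ultimately have "cot (pi * (x / 2)) - cot (pi * x) = 1 / sin (pi * x)"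
      unfolding cot_def by fastforce
    then show ?thesis
      by (simp flip: right_diff_distrib)
  qed
  ultimately show ?thesis
    by (simp add: Beta_reflection_real)
qed

lemma pole_pair_reflected:
  assumes "\<bar>y\<bar> < 1/2"
  shows "pole_pair n (1/2 - y) = (2 * real n + 1) / ((real n + 1/2)\<^sup>2 - y\<^sup>2)"
proof -
  have "real n + 1/2 - y \<noteq> 0" "real n + 1/2 + y \<noteq> 0"
    using assms by linarith+
  then have "1 / (real n + 1/2 - y) + 1 / (real n + 1/2 + y) = (2 * real n + 1) / ((real n + 1/2 - y) * (real n + 1/2 + y))"
    by (simp add: add_frac_eq)
  then show ?thesis
    by (simp add: pole_pair_def algebra_simps power2_eq_square)
qed

section \<open>Weights of the poles and the alternating sum E\<close>

text \<open>This is \<open>(n + 1/2)\<^sup>2 - 5/4\<close>, the distance in the variable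
  \<open>y\<^sup>2\<close> from the zero of \<open>1 + x * (1 - x)\<close> to the n-th pole.\<close>

definition pole_gap :: "nat \<Rightarrow> real" where
  "pole_gap n = real n * (real n + 1) - 1"

definition gap_ratio :: "nat \<Rightarrow> real" where
  "gap_ratio n = (2 * real n + 1) / pole_gap n"

lemma pole_gap_ge_1:
  assumes "n > 0"
  shows "pole_gap n \<ge> 1"
proof -
  have "1 * 2 \<le> real n * (real n + 1)"
    using assms by (intro mult_mono) auto
  then show ?thesis
    by (simp add: pole_gap_def)
qed

lemma pole_gap_nonzero: "pole_gap n \<noteq> 0"
  using pole_gap_ge_1[of n] by (cases "n = 0") (auto simp: pole_gap_def)

text \<open>For \<open>n = 0\<close> the gap is -1 and the weight vanishes, cancelling the nearest
  pole; all other gaps are at least 1.\<close>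

lemma pole_weight_nonneg: "0 \<le> 1 + (-1) ^ n / pole_gap n"
proof (cases "n = 0")
  case False
  then have "\<bar>(-1) ^ n / pole_gap n\<bar> \<le> 1"
    using pole_gap_ge_1[of n] by (simp add: abs_divide power_abs)
  then show ?thesis
    by linarith
qed (simp add: pole_gap_def)

lemma gap_ratio_Suc_le:
  assumes "n > 0"
  shows "gap_ratio (Suc n) \<le> gap_ratio n"
proof -
  have "gap_ratio n - gap_ratio (Suc n) =
      (2 * real n ^ 2 + 4 * real n + 4) / (pole_gap n * pole_gap (Suc n))"
    using pole_gap_nonzero[of n] pole_gap_nonzero[of "Suc n"]
    by (simp add: gap_ratio_def diff_frac_eq) (simp add: pole_gap_def algebra_simps power2_eq_square)
  also have "\<dots> \<ge> 0"
    using pole_gap_ge_1[of n] pole_gap_ge_1[of "Suc n"] assms by (intro divide_nonneg_nonneg) auto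
  finally show ?thesis
    by simp
qed

text \<open>The block \<open>k = 0\<close> equals -1 - 3 = -4. The later blocks are dominated by a
  telescoping series with sum \<open>gap_ratio 2 = 1\<close>, so E is at most -3.\<close>

lemma gap_ratio_alternating_sums:
  obtains E where "(\<lambda>k. gap_ratio (2 * k) - gap_ratio (2 * k + 1)) sums E" "E \<le> 0"
proof -
  let ?e = "\<lambda>k. gap_ratio (2 * k) - gap_ratio (2 * k + 1)"
  let ?h = "\<lambda>k. gap_ratio (2 * k + 2)"
  have "?h \<longlonglongrightarrow> 0"
    unfolding gap_ratio_def pole_gap_def by real_asymp
  then have h: "(\<lambda>k. ?h k - ?h (Suc k)) sums ?h 0"
    using telescope_sums'[of ?h 0] by simp
  \<comment> \<open>Both bounds come from monotonicity: \<open>gap_ratio (2 * k + 3)\<close> lies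
    between \<open>?h (Suc k)\<close> and \<open>?h k\<close>.\<close>
  have bounds: "0 \<le> ?e (Suc k)" "?e (Suc k) \<le> ?h k - ?h (Suc k)" for k
    using gap_ratio_Suc_le[of "2 * k + 2"] gap_ratio_Suc_le[of "2 * k + 3"]
    by (simp_all add: eval_nat_numeral)
  have "summable (\<lambda>k. ?e (Suc k))"
    using bounds by (intro summable_comparison_test'[OF sums_summable[OF h], of 0]) auto
  then obtain t where t: "(\<lambda>k. ?e (Suc k)) sums t"
    by (auto simp: summable_def)
  then have "t \<le> ?h 0"
    by (rule sums_le[OF bounds(2) _ h])
  moreover have "?h 0 = 1" "?e 0 = -4"
    by (simp_all add: gap_ratio_def pole_gap_def)
  moreover have "?e sums (t + ?e 0)"
    using t by (rule sums_Suc)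
  ultimately show ?thesis
    by (intro that[of "t + ?e 0"]) simp_all
qed

section \<open>Partial fractions and paired blocks\<close>

text \<open>With \<open>C = 5/4 - y\<^sup>2\<close> and \<open>d = pole_gap n\<close>, this is
  \<open>1 / ((C + d) * C) = (1 / C - 1 / (C + d)) / d\<close>. The parameter \<epsilon> is the sign
  of the n-th term in the series for B.\<close>

lemma pole_partial_fraction:
  fixes y \<epsilon> :: real
  assumes "\<bar>y\<bar> < 1/2"
  shows "pole_pair n (1/2 - y) - \<epsilon> * pole_pair n (1/2 - y) / (5/4 - y\<^sup>2) =
    (2 * real n + 1) * (1 + \<epsilon> / pole_gap n) * (1 / ((real n + 1/2)\<^sup>2 - y\<^sup>2)) - \<epsilon> * gap_ratio n * (1 / (5/4 - y\<^sup>2))"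
proof -
  have y: "y\<^sup>2 < 1/4"
    using power_strict_mono[OF assms abs_ge_zero pos2] by (simp add: power_divide)
  define C where "C = 5/4 - y\<^sup>2"
  have A: "(real n + 1/2)\<^sup>2 - y\<^sup>2 = C + pole_gap n"
    by (simp add: C_def pole_gap_def power2_eq_square algebra_simps)
  have "(real n + 1/2)\<^sup>2 \<ge> 1/4"
    by (simp add: power2_eq_square algebra_simps)
  then have "C + pole_gap n \<noteq> 0" "C \<noteq> 0"
    using y A by (auto simp: C_def)
  then have "m / (C + d) - \<epsilon> * m / (C + d) / C = m * (1 + \<epsilon> / d) * (1 / (C + d)) - \<epsilon> * (m / d) * (1 / C)"
    if "d = pole_gap n" for m d :: real
    using that pole_gap_nonzero[of n] by (simp add: divide_simps) (simp add: algebra_simps)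
  then show ?thesis
    unfolding pole_pair_reflected[OF assms] A C_def[symmetric] gap_ratio_def by simp
qed

text \<open>The series for \<open>B\<close> converges only conditionally, so even and odd terms are kept paired.\<close>

definition R_minus_B_block :: "nat \<Rightarrow> real \<Rightarrow> real" where
  "R_minus_B_block k y =
     (\<Sum>n\<in>{2 * k, 2 * k + 1}. pole_pair n (1/2 - y) - 2 / (real n + 1)) -
     (pole_pair (2 * k) (1/2 - y) - pole_pair (2 * k + 1) (1/2 - y)) / (5/4 - y\<^sup>2)"

lemma R_minus_B_block_sums:
  assumes "\<bar>y\<bar> < 1/2"
  shows "(\<lambda>k. R_minus_B_block k y) sums
    (Ramanujan_R (1/2 - y) (1 - (1/2 - y)) -
     Beta (1/2 - y) (1 - (1/2 - y)) / (1 + (1/2 - y) * (1 - (1/2 - y))))"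
proof -
  have x: "0 < 1/2 - y" "1/2 - y < 1"
    using assms by linarith+
  have "{k * 2..<k * 2 + 2} = {2 * k, 2 * k + 1}" for k :: nat
    by auto
  then have R: "(\<lambda>k. \<Sum>n\<in>{2 * k, 2 * k + 1}. pole_pair n (1/2 - y) - 2 / (real n + 1))
      sums Ramanujan_R (1/2 - y) (1 - (1/2 - y))"
    using sums_group[OF sums_Ramanujan_R[OF x], of 2] by simp
  have "1 + (1/2 - y) * (1 - (1/2 - y)) = 5/4 - y\<^sup>2"
    by (simp add: algebra_simps power2_eq_square)
  then show ?thesis
    unfolding R_minus_B_block_def
    using sums_diff[OF R sums_divide[OF sums_Beta_reflection[OF x], of "5/4 - y\<^sup>2"]] by simp
qed

text \<open>Subtracting the value at 0 cancels the constants \<open>2 / (n + 1)\<close>, and the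
  added \<open>gap_ratio\<close> term cancels the pole at \<open>y\<^sup>2 = 5/4\<close>. Only
  nonnegatively weighted terms remain.\<close>

lemma R_minus_B_block_eq:
  assumes "\<bar>y\<bar> < 1/2"
  shows "R_minus_B_block k y - R_minus_B_block k 0 +
      (gap_ratio (2 * k) - gap_ratio (2 * k + 1)) * (1 / (5/4 - y\<^sup>2) - 1 / (5/4)) =
    (\<Sum>n\<in>{2 * k, 2 * k + 1}. (2 * real n + 1) * (1 + (-1) ^ n / pole_gap n) *
      (1 / ((real n + 1/2)\<^sup>2 - y\<^sup>2) - 1 / (real n + 1/2)\<^sup>2))"
proof -
  define W where "W n z = (2 * real n + 1) * (1 + (-1) ^ n / pole_gap n) * (1 / ((real n + 1/2)\<^sup>2 - z\<^sup>2))" for n z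
  have "R_minus_B_block k z = W (2 * k) z + W (2 * k + 1) z
      - 2 / (real (2 * k) + 1) - 2 / (real (2 * k + 1) + 1)
      - (gap_ratio (2 * k) - gap_ratio (2 * k + 1)) * (1 / (5/4 - z\<^sup>2))" if "\<bar>z\<bar> < 1/2" for z
  proof -
    have "pole_pair (2 * k) (1/2 - z) - pole_pair (2 * k) (1/2 - z) / (5/4 - z\<^sup>2) =
        W (2 * k) z - gap_ratio (2 * k) / (5/4 - z\<^sup>2)"
      using pole_partial_fraction[OF that, of "2 * k" 1] by (simp add: W_def)
    moreover have "pole_pair (2 * k + 1) (1/2 - z) + pole_pair (2 * k + 1) (1/2 - z) / (5/4 - z\<^sup>2) =
        W (2 * k + 1) z + gap_ratio (2 * k + 1) / (5/4 - z\<^sup>2)"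
      using pole_partial_fraction[OF that, of "2 * k + 1" "-1"] by (simp add: W_def)
    ultimately show ?thesis
      by (simp add: R_minus_B_block_def diff_divide_distrib)
  qed
  from this[OF assms] this[of 0] show ?thesis
    by (simp add: W_def right_diff_distrib left_diff_distrib)
qed

section \<open>Value at the center and conclusion\<close>

text \<open>Machin's formula gives \<open>pi \<le> 16/5\<close>, and \<open>ln 2 \<ge> 2/3\<close>,
  so the claim reduces to \<open>8/3 \<ge> 64/25\<close>.\<close>

lemma R_minus_B_center_nonneg: "Ramanujan_R (1/2) (1/2) - Beta (1/2) (1/2) / (5/4) \<ge> 0"
proof -
  have "pi / 4 \<le> 4 * (1/5)"
    using machin arctan_le_self[of "1/5"] arctan_le_self[of "1/239"] zero_le_arctan_iff[of "1/239"]
    by linarith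
  moreover have "Beta (1/2) (1/2) = pi"
    using Beta_reflection_real[of "1/2"] by simp
  moreover have "Ramanujan_R (1/2) (1/2) = 4 * ln 2"
    by (simp add: Ramanujan_R_def Digamma_one_half)
  ultimately show ?thesis
    using ln2_ge_two_thirds by simp
qed

theorem theorem7:
  shows "completely_monotonic_on
    (\<lambda>x::real. Ramanujan_R x (1 - x) - Beta x (1 - x) / (1 + x * (1 - x))) {0<..<1/2}"
proof -
  define F where "F y = Ramanujan_R (1/2 - y) (1 - (1/2 - y)) -
     Beta (1/2 - y) (1 - (1/2 - y)) / (1 + (1/2 - y) * (1 - (1/2 - y)))" for y :: real
  define V where "V y = 1 / (5/4 - y\<^sup>2) - 1 / (5/4)" for y :: real
  obtain E where E: "(\<lambda>k. gap_ratio (2 * k) - gap_ratio (2 * k + 1)) sums E" "E \<le> 0"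
    using gap_ratio_alternating_sums .
  have V: "nonneg_power_series_on (1/2) V"
    unfolding V_def
    by (rule nonneg_power_series_on_inverse_diff_square) (simp_all add: power2_eq_square)
  have F0: "0 \<le> F 0"
    using R_minus_B_center_nonneg by (simp add: F_def)
  have "nonneg_power_series_on (1/2) (\<lambda>y. F y - F 0 + E * V y)"
  proof (rule nonneg_power_series_on_sums)
    let ?T = "\<lambda>n y. (2 * real n + 1) * (1 + (-1) ^ n / pole_gap n) *
      (1 / ((real n + 1/2)\<^sup>2 - y\<^sup>2) - 1 / (real n + 1/2)\<^sup>2)"
    have T: "nonneg_power_series_on (1/2) (?T n)" for n
    proof (intro nonneg_power_series_on_cmult nonneg_power_series_on_inverse_diff_square)
      show "0 \<le> (2 * real n + 1) * (1 + (-1) ^ n / pole_gap n)"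
        using pole_weight_nonneg by simp
      show "(1/2)\<^sup>2 \<le> (real n + 1/2)\<^sup>2"
        by (intro power_mono) auto
    qed simp
    show "nonneg_power_series_on (1/2) (\<lambda>y. \<Sum>n\<in>{2 * k, 2 * k + 1}. ?T n y)" for k
      using nonneg_power_series_on_add[OF T[of "2 * k"] T[of "2 * k + 1"]] by simp
    show "(\<lambda>k. \<Sum>n\<in>{2 * k, 2 * k + 1}. ?T n y) sums (F y - F 0 + E * V y)"
      if "0 < y" "y < 1/2" for y
    proof -
      have y: "\<bar>y\<bar> < 1/2"
        using that by simp
      have "(\<lambda>k. R_minus_B_block k y - R_minus_B_block k 0 +
          (gap_ratio (2 * k) - gap_ratio (2 * k + 1)) * V y) sums (F y - F 0 + E * V y)"
        unfolding F_def
        by (intro sums_add sums_diff sums_mult2 R_minus_B_block_sums y E) simp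
      then show ?thesis
        unfolding V_def R_minus_B_block_eq[OF y] .
    qed
  qed
  \<comment> \<open>The part of \<open>F\<close> left over by the series above: a nonnegative
    constant, and \<open>V\<close> with the nonnegative factor \<open>- E\<close>.\<close>
  moreover have "nonneg_power_series_on (1/2) (\<lambda>y. F 0 * y ^ 0 + - E * V y)"
    using F0 V E(2)
    by (intro nonneg_power_series_on_add nonneg_power_series_on_monom nonneg_power_series_on_cmult) auto
  ultimately have "nonneg_power_series_on (1/2) (\<lambda>y. (F y - F 0 + E * V y) + (F 0 * y ^ 0 + - E * V y))"
    by (rule nonneg_power_series_on_add)
  then have "nonneg_power_series_on (1/2) F"
    by simp
  \<comment> \<open>With \<open>b = r = 1/2\<close> the interval is \<open>{0<..<1/2}\<close>, and
    \<open>F (1/2 - x)\<close> is the function of the theorem.\<close>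
  from completely_monotonic_on_reflected_power_series[OF this, of "1/2"] show ?thesis
    by (simp add: F_def)
qed

end
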